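(* Let $\alpha,\beta,\gamma$ be real numbers with $\alpha\beta+\gamma\neq 0$, let $n\in\mathbb{N}$, and let $Lp_n(\alpha,\beta,\gamma)=(k_{ij})_{1\le i,j\le n+1}$ be the matrix whose entries are defined by the recurrence relation $$\alpha k_{i,j-1}+\beta k_{i-1,j}+\gamma k_{i-1,j-1}=k_{ij},\qquad 2\le i,j\le n+1,$$ with $k_{1j}=\alpha^{j-1}$ for $j\in\{1,\ldots,n+1\}$ and $k_{i1}=\beta^{i-1}$ for $i\in\{1,\ldots,n+1\}$. Then its bidiagonal decomposition is given by $$\left(\mathcal{BD}(Lp_n(\alpha,\beta,\gamma))\right)_{ij}=\begin{cases}(\alpha\beta+\gamma)^{i-1},& \text{if } i=j,\\ \alpha,& \text{if } i>j,\\ \beta,& \text{if } i<j,\end{cases}\qquad 1\le i,j\le n+1.$$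
   Context: Bidiagonal decomposition and the notation $\mathcal{BD}(A)$: for an $N\times N$ real matrix $A$, a bidiagonal decomposition is a factorization $$A=F_{N-1}F_{N-2}\cdots F_1\,D\,G_1\cdots G_{N-2}G_{N-1},$$ where $D=\mathrm{diag}(p_{11},\ldots,p_{NN})$; for each $i\in\{1,\ldots,N-1\}$, $F_i$ is the lower bidiagonal matrix with all diagonal entries equal to $1$ and whose subdiagonal entry in position $(r,r-1)$ is $0$ for $2\le r\le i$ and $m_{r,r-i}$ for $i+1\le r\le N$; and $G_i$ is the upper bidiagonal matrix with all diagonal entries equal to $1$ and whose superdiagonal entry in position $(r-1,r)$ is $0$ for $2\le r\le i$ and $\widetilde m_{r,r-i}$ for $i+1\le r\le N$. The data of the decomposition are stored in the $N\times N$ matrix $\mathcal{BD}(A)$ with $$(\mathcal{BD}(A))_{ij}=\begin{cases} m_{ij},& i>j,\\ \widetilde m_{ji},& i<j,\\ p_{ii},& i=j.\end{cases}$$ Thus a formula for $\mathcal{BD}(A)$ asserts that $A$ equals the product above with the indicated values of $m_{ij}$, $\widetilde m_{ij}$, $p_{ii}$. Here $N=n+1$. Convention: $0^0=1$.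
   Formalization: The off-diagonal values are exchanged: BD has β for i > j and α for i < j, because with the given conventions the (2,1) entry of the product is m_{21}p_{11}, which must equal k_{21} = β (the printed formula fails e.g. for n = 1, α = 1, β = 0, γ = 1). *)

theory Defs
  imports Complex_Main "Jordan_Normal_Form.Matrix"
begin

text \<open>
  Matrix indices start at 0 here, so position \<open>(r, c)\<close> is the position \<open>(r + 1, c + 1)\<close> of the
  usual 1-based notation. A matrix \<open>B\<close> stores the data of a bidiagonal decomposition: the pivots
  on the diagonal, the multipliers \<open>m\<close> of the lower factors below it, and the multipliers of
  the upper factors, transposed, above it.
\<close>

definition lower_factor :: "real mat \<Rightarrow> nat \<Rightarrow> real mat" where
  "lower_factor B i = mat (dim_row B) (dim_row B) (\<lambda>(r, c).
     if r = c then 1 else if r = c + 1 \<and> i \<le> r then B $$ (r, r - i) else 0)"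

definition upper_factor :: "real mat \<Rightarrow> nat \<Rightarrow> real mat" where
  "upper_factor B i = mat (dim_row B) (dim_row B) (\<lambda>(r, c).
     if r = c then 1 else if c = r + 1 \<and> i \<le> c then B $$ (c - i, c) else 0)"

text \<open>
  With \<open>N = dim_row B\<close>, the fold builds
  \<open>F_(N-1) * (... * (F_1 * D * G_1) * ...) * G_(N-1)\<close> from the inside out.
\<close>

definition bidiagonal_product :: "real mat \<Rightarrow> real mat" where
  "bidiagonal_product B =
     fold (\<lambda>i M. lower_factor B i * M * upper_factor B i) [1..<dim_row B]
       (mat_diag (dim_row B) (\<lambda>i. B $$ (i, i)))"

definition is_BD :: "real mat \<Rightarrow> real mat \<Rightarrow> bool" where
  "is_BD A B \<longleftrightarrow> square_mat A \<and> B \<in> carrier_mat (dim_row A) (dim_row A) \<and> A = bidiagonal_product B"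

text \<open>
  The first row holds the powers of \<open>\<alpha>\<close> and the first column those of \<open>\<beta>\<close>. Position
  \<open>(1, 0)\<close> of a bidiagonal product is the lower multiplier times the first pivot, which is 1 here,
  so the lower multipliers of this matrix are \<open>\<beta>\<close> and the upper ones \<open>\<alpha>\<close>; with the two
  exchanged one obtains the transpose.
\<close>

fun lp_entry :: "real \<Rightarrow> real \<Rightarrow> real \<Rightarrow> nat \<Rightarrow> nat \<Rightarrow> real" where
  "lp_entry \<alpha> \<beta> \<gamma> 0 j = \<alpha> ^ j"
| "lp_entry \<alpha> \<beta> \<gamma> (Suc i) 0 = \<beta> ^ Suc i"
| "lp_entry \<alpha> \<beta> \<gamma> (Suc i) (Suc j) =
     \<alpha> * lp_entry \<alpha> \<beta> \<gamma> (Suc i) j + \<beta> * lp_entry \<alpha> \<beta> \<gamma> i (Suc j) + \<gamma> * lp_entry \<alpha> \<beta> \<gamma> i j"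

definition Lp :: "nat \<Rightarrow> real \<Rightarrow> real \<Rightarrow> real \<Rightarrow> real mat" where
  "Lp n \<alpha> \<beta> \<gamma> = mat (n + 1) (n + 1) (\<lambda>(i, j). lp_entry \<alpha> \<beta> \<gamma> i j)"

end

theory Submission
  imports Defs
begin

text \<open>
  Put \<open>d = \<alpha> * \<beta> + \<gamma>\<close> and pair polynomials by \<open>\<langle>x^s, x^t\<rangle> = (if s = t then d ^ s else 0)\<close>, so that
  \<open>\<langle>x f, x h\<rangle> = d \<langle>f, h\<rangle>\<close>. Expanding \<open>\<langle>(x + \<beta>) f, (x + \<alpha>) h\<rangle>\<close> shows that \<open>\<langle>(x + \<beta>)^i, (x + \<alpha>)^j\<rangle>\<close>
  obeys the recurrence of the Pascal-type matrix. On the other side, multiplication by the \<open>k\<close>-th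
  lower factor trades a factor \<open>x\<close> for \<open>x + \<beta>\<close> in each row \<open>r \<ge> k\<close>, and likewise for the upper
  factors and columns. Starting from the diagonal matrix of the \<open>\<langle>x^r, x^c\<rangle>\<close>, after \<open>k\<close> steps
  position \<open>(r, c)\<close> holds the pairing of \<open>x^(r - k) (x + \<beta>)^(min k r)\<close> with
  \<open>x^(c - k) (x + \<alpha>)^(min k c)\<close>.
\<close>

text \<open>\<open>pairing \<alpha> \<beta> d p i q j\<close> is \<open>\<langle>x^p (x + \<beta>)^i, x^q (x + \<alpha>)^j\<rangle>\<close>.\<close>

fun pairing :: "real \<Rightarrow> real \<Rightarrow> real \<Rightarrow> nat \<Rightarrow> nat \<Rightarrow> nat \<Rightarrow> nat \<Rightarrow> real" where
  "pairing \<alpha> \<beta> d p 0 q 0 = (if p = q then d ^ p else 0)"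
| "pairing \<alpha> \<beta> d p 0 q (Suc j) = pairing \<alpha> \<beta> d p 0 (Suc q) j + \<alpha> * pairing \<alpha> \<beta> d p 0 q j"
| "pairing \<alpha> \<beta> d p (Suc i) q j = pairing \<alpha> \<beta> d (Suc p) i q j + \<beta> * pairing \<alpha> \<beta> d p i q j"

text \<open>The defining equations expand the right factor only once the left one is used up;
  bilinearity removes this order.\<close>

lemma pairing_Suc_right:
  "pairing \<alpha> \<beta> d p i q (Suc j) = pairing \<alpha> \<beta> d p i (Suc q) j + \<alpha> * pairing \<alpha> \<beta> d p i q j"
  by (induction i arbitrary: p) (simp_all add: algebra_simps)

lemma pairing_shift:
  "pairing \<alpha> \<beta> d (Suc p) i (Suc q) j = d * pairing \<alpha> \<beta> d p i q j"
  by (induction \<alpha> \<beta> d p i q j rule: pairing.induct) (simp_all add: algebra_simps)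

text \<open>The right polynomial is divisible by \<open>x^q\<close>, so it has no monomial
  \<open>x^p\<close>.\<close>

lemma pairing_eq_0_left: "p < q \<Longrightarrow> pairing \<alpha> \<beta> d p 0 q j = 0"
  by (induction j arbitrary: q) simp_all

lemma pairing_eq_0_right: "q < p \<Longrightarrow> pairing \<alpha> \<beta> d p i q 0 = 0"
  by (induction i arbitrary: p) simp_all

lemma pairing_power_left: "pairing \<alpha> \<beta> d 0 i 0 0 = \<beta> ^ i"
  by (induction i) (simp_all add: pairing_eq_0_right)

lemma pairing_power_right: "pairing \<alpha> \<beta> d 0 0 0 j = \<alpha> ^ j"
  by (induction j) (simp_all add: pairing_eq_0_left)

lemma lp_entry_eq_pairing:
  "lp_entry \<alpha> \<beta> \<gamma> i j = pairing \<alpha> \<beta> (\<alpha> * \<beta> + \<gamma>) 0 i 0 j"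
proof (induction \<alpha> \<beta> \<gamma> i j rule: lp_entry.induct)
  case (1 \<alpha> \<beta> \<gamma> j)
  show ?case by (simp add: pairing_power_right)
next
  case (2 \<alpha> \<beta> \<gamma> i)
  show ?case by (simp add: pairing_power_left del: pairing.simps(3))
next
  case (3 \<alpha> \<beta> \<gamma> i j)
  \<comment> \<open>Rewriting the cross terms by the recurrence leaves the coefficient
    \<open>d - \<alpha> * \<beta>\<close>, which is \<gamma>.\<close>
  then show ?case
    by (simp add: pairing_Suc_right pairing_shift algebra_simps)
qed

lemma lower_factor_mult_index:
  assumes "M \<in> carrier_mat (dim_row B) m" "0 < i" "r < dim_row B" "c < m"
  shows "(lower_factor B i * M) $$ (r, c) =
    M $$ (r, c) + (if i \<le> r then B $$ (r, r - i) * M $$ (r - 1, c) else 0)"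
proof -
  \<comment> \<open>As \<open>0 < i\<close>, the case \<open>i \<le> r\<close> forces
    \<open>0 < r\<close>, so \<open>r - 1\<close> is a genuine row above \<open>r\<close>.\<close>
  have "(lower_factor B i * M) $$ (r, c) =
      (\<Sum>s = 0..<dim_row B. (if s = r then M $$ (s, c) else 0) +
        (if s = r - 1 then if i \<le> r then B $$ (r, r - i) * M $$ (s, c) else 0 else 0))"
    using assms
    by (auto simp: lower_factor_def scalar_prod_def intro!: sum.cong)
  also have "\<dots> = M $$ (r, c) + (if i \<le> r then B $$ (r, r - i) * M $$ (r - 1, c) else 0)"
    using assms(3) by (auto simp: sum.distrib sum.delta)
  finally show ?thesis .
qed

lemma mult_upper_factor_index:
  assumes "M \<in> carrier_mat m (dim_row B)" "0 < i" "r < m" "c < dim_row B"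
  shows "(M * upper_factor B i) $$ (r, c) =
    M $$ (r, c) + (if i \<le> c then B $$ (c - i, c) * M $$ (r, c - 1) else 0)"
proof -
  have "(M * upper_factor B i) $$ (r, c) =
      (\<Sum>s = 0..<dim_row B. (if s = c then M $$ (r, s) else 0) +
        (if s = c - 1 then if i \<le> c then B $$ (c - i, c) * M $$ (r, s) else 0 else 0))"
    using assms
    by (auto simp: upper_factor_def scalar_prod_def intro!: sum.cong)
  also have "\<dots> = M $$ (r, c) + (if i \<le> c then B $$ (c - i, c) * M $$ (r, c - 1) else 0)"
    using assms(4) by (auto simp: sum.distrib sum.delta)
  finally show ?thesis .
qed

lemma fold_factors_eq_pairing:
  fixes \<alpha> \<beta> d :: real and N :: nat
  defines "B \<equiv> mat N N (\<lambda>(i, j). if i = j then d ^ i else if i > j then \<beta> else \<alpha>)"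
  shows "fold (\<lambda>i M. lower_factor B i * M * upper_factor B i) [1..<Suc k]
      (mat_diag N (\<lambda>i. B $$ (i, i))) =
    mat N N (\<lambda>(r, c). pairing \<alpha> \<beta> d (r - k) (min k r) (c - k) (min k c))"
proof (induction k)
  case 0
  show ?case by (auto simp: B_def mat_diag_def)
next
  case (Suc k)
  define M where
    "M = mat N N (\<lambda>(r, c). pairing \<alpha> \<beta> d (r - k) (min k r) (c - k) (min k c))"
  \<comment> \<open>Half a step: rows have advanced to \<open>Suc k\<close>, columns are still at
    \<open>k\<close>.\<close>
  define L where
    "L = mat N N (\<lambda>(r, c). pairing \<alpha> \<beta> d (r - Suc k) (min (Suc k) r) (c - k) (min k c))"
  have dim [simp]: "dim_row B = N" by (simp add: B_def)
  have dimL [simp]: "dim_row (lower_factor B i) = N" "dim_col (upper_factor B i) = N" for i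
    by (simp_all add: lower_factor_def upper_factor_def)
  have Suc_split: "r - k = Suc (r - Suc k) \<and> min k r = k \<and> min (Suc k) r = Suc k \<and>
      min k (r - 1) = k \<and> r - 1 - k = r - Suc k" if "Suc k \<le> r" for r
    using that by auto
  have le_split: "min k r = r \<and> min (Suc k) r = r \<and> r - k = 0 \<and> r - Suc k = 0"
    if "\<not> Suc k \<le> r" for r
    using that by auto
  have L: "lower_factor B (Suc k) * M = L"
  proof (rule eq_matI)
    fix r c assume "r < dim_row L" "c < dim_col L"
    then have rc: "r < N" "c < N" by (simp_all add: L_def)
    have "(lower_factor B (Suc k) * M) $$ (r, c) = M $$ (r, c) +
        (if Suc k \<le> r then B $$ (r, r - Suc k) * M $$ (r - 1, c) else 0)"
      using rc by (intro lower_factor_mult_index[where m = N]) (simp_all add: M_def)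
    also have "\<dots> = L $$ (r, c)"
    proof (cases "Suc k \<le> r")
      case True
      then have "B $$ (r, r - Suc k) = \<beta>" using rc by (auto simp: B_def)
      \<comment> \<open>Row \<open>r - 1\<close> has one factor \<open>x\<close> less than row
        \<open>r\<close>, so adding \<beta> times it turns that \<open>x\<close> into
        \<open>x + \<beta>\<close>.\<close>
      then show ?thesis
        using rc Suc_split[OF True] True by (simp add: M_def L_def)
    next
      case False
      then show ?thesis
        using rc le_split[OF False] by (simp add: M_def L_def)
    qed
    finally show "(lower_factor B (Suc k) * M) $$ (r, c) = L $$ (r, c)" .
  qed (simp_all add: M_def L_def)
  have U: "L * upper_factor B (Suc k) = mat N N (\<lambda>(r, c).
      pairing \<alpha> \<beta> d (r - Suc k) (min (Suc k) r) (c - Suc k) (min (Suc k) c))" (is "_ = ?U")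
  proof (rule eq_matI)
    fix r c assume "r < dim_row ?U" "c < dim_col ?U"
    then have rc: "r < N" "c < N" by simp_all
    have "(L * upper_factor B (Suc k)) $$ (r, c) = L $$ (r, c) +
        (if Suc k \<le> c then B $$ (c - Suc k, c) * L $$ (r, c - 1) else 0)"
      using rc by (intro mult_upper_factor_index[where m = N]) (simp_all add: L_def)
    also have "\<dots> = ?U $$ (r, c)"
    proof (cases "Suc k \<le> c")
      case True
      then have "B $$ (c - Suc k, c) = \<alpha>" using rc by (auto simp: B_def)
      then show ?thesis
        using rc Suc_split[OF True] True by (simp add: L_def pairing_Suc_right)
    next
      case False
      then show ?thesis
        using rc le_split[OF False] by (simp add: L_def)
    qed
    finally show "(L * upper_factor B (Suc k)) $$ (r, c) = ?U $$ (r, c)" .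
  qed (simp_all add: L_def)
  have "fold (\<lambda>i M. lower_factor B i * M * upper_factor B i) [1..<Suc (Suc k)]
      (mat_diag N (\<lambda>i. B $$ (i, i))) = lower_factor B (Suc k) * M * upper_factor B (Suc k)"
    using Suc.IH by (simp add: M_def)
  then show ?case by (simp only: L U)
qed

theorem theorem8:
  fixes \<alpha> \<beta> \<gamma> :: real and n :: nat
  assumes "\<alpha> * \<beta> + \<gamma> \<noteq> 0"
  shows "is_BD (Lp n \<alpha> \<beta> \<gamma>)
    (mat (n + 1) (n + 1) (\<lambda>(i, j).
       if i = j then (\<alpha> * \<beta> + \<gamma>) ^ i else if i > j then \<beta> else \<alpha>))"
    (is "is_BD ?A ?B")
proof -
  have "bidiagonal_product ?B = mat (n + 1) (n + 1) (\<lambda>(r, c).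
      pairing \<alpha> \<beta> (\<alpha> * \<beta> + \<gamma>) (r - n) (min n r) (c - n) (min n c))"
    using fold_factors_eq_pairing[where N = "n + 1" and k = n]
    unfolding bidiagonal_product_def by simp
  \<comment> \<open>All indices are at most \<open>n\<close>, so no power of \<open>x\<close> is
    left.\<close>
  also have "\<dots> = ?A"
    by (rule eq_matI) (auto simp: Lp_def lp_entry_eq_pairing min_absorb2)
  finally show ?thesis
    by (simp add: is_BD_def Lp_def)
qed

end
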